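(* Suppose $A^k_t(j)=A^k>0$ and $A^l_t(j)=e^{\alpha j}$ with $\alpha>0$, and let $\sigma>0$, $\sigma\neq1$. Then technological unemployment $U^A_t$ (defined in the context) equals $$U^A_t=L_t\left(1-e^{\alpha(\sigma-1)(\dot M_t-\dot m^*_t)}\;\frac{e^{\alpha(\sigma-1)(m^*_t+\dot m^*_t)}-1}{e^{\alpha(\sigma-1)m^*_t}-1}\right).$$ Moreover, writing $U^A_{L_t}=\partial U^A_t/\partial L_t$, in the steady state ($\dot m^*_t=0$) the following hold. If $\sigma>1$: $U^A_{L_t}<0$ when $\dot M_t>0$; $U^A_{L_t}>0$ when $\dot M_t<0$; $\partial U^A_{L_t}/\partial\dot M_t<0$; $\partial U^A_{L_t}/\partial\dot m^*_t<0$ if $m^*_t=m_t$; and $\partial U^A_{L_t}/\partial m^*_t=0$. If $\sigma\in(0,1)$: $U^A_{L_t}>0$ when $\dot M_t>0$; $U^A_{L_t}<0$ when $\dot M_t<0$; $\partial U^A_{L_t}/\partial\dot M_t>0$; $\partial U^A_{L_t}/\partial\dot m^*_t<0$ if $m^*_t=m_t$; and $\partial U^A_{L_t}/\partial m^*_t=0$.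
   Context: Tasks $j$ are indexed over $[M_t-1,M_t]$. Tasks $j\le J^*_t$ are produced with capital and tasks $j\in(J^*_t,M_t]$ with labor, where $J^*_t=\min\{J_t,\tilde J_t\}$, $J_t$ is the technological limit of automation and $\tilde J_t$ the cost threshold. The automation measure is $m^*_t=M_t-J^*_t\in(0,1)$; $m_t=M_t-J_t$, so $m^*_t=m_t$ means that automation is limited by technology. Output is a CES aggregate of tasks with elasticity of substitution $\sigma$; a labor task has unit cost $W_t/A^l_t(j)$, so the demand for task $j$ is proportional to $(W_t/A^l_t(j))^{-\sigma}$ and labor employed in it is $l_t(j)=$ (demand for task $j$)$/A^l_t(j)$, i.e. $l_t(j)=B_te^{\alpha(\sigma-1)j}$ with $B_t>0$ independent of $j$ (the same expression is used for newly created tasks). Total employment is $L_t=\int_{J^*_t}^{M_t}l_t(j)\,dj$. Technological unemployment is the displacement effect minus the reinstatement effect over one unit of time: $$U^A_t=\int_{J^*_t}^{J^*_{t+dt}}l_t(j)\,dj-\int_{M_t}^{M_{t+dt}}l_t(j)\,dj,$$ with the increments over the time unit being $M_{t+dt}-M_t=\dot M_t$ and $J^*_{t+dt}-J^*_t=\dot J^*_t=\dot M_t-\dot m^*_t$. In the derivatives, $U^A_{L_t}$ is regarded as a function of $(\dot M_t,\dot m^*_t,m^*_t)$, evaluated at $\dot m^*_t=0$. *)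

theory Defs
  imports "HOL-Analysis.Analysis"
begin

text \<open>
  Demand for a task produced with labor: by the CES aggregator it is proportional to the unit
  cost \<open>W / Al j\<close> raised to the power \<open>-\<sigma>\<close>; \<open>D\<close> is the factor of proportionality, common to
  all tasks.
\<close>

definition task_demand :: "real \<Rightarrow> real \<Rightarrow> real \<Rightarrow> (real \<Rightarrow> real) \<Rightarrow> real \<Rightarrow> real" where
  "task_demand D W \<sigma> Al j = D * (W / Al j) powr (-\<sigma>)"

definition task_labor :: "real \<Rightarrow> real \<Rightarrow> real \<Rightarrow> (real \<Rightarrow> real) \<Rightarrow> real \<Rightarrow> real" where
  "task_labor D W \<sigma> Al j = task_demand D W \<sigma> Al j / Al j"

definition total_employment ::
    "real \<Rightarrow> real \<Rightarrow> real \<Rightarrow> (real \<Rightarrow> real) \<Rightarrow> real \<Rightarrow> real \<Rightarrow> real" where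
  "total_employment D W \<sigma> Al Jstar M = (LBINT j=Jstar..M. task_labor D W \<sigma> Al j)"

text \<open>
  Displacement minus reinstatement, when the automation threshold moves from \<open>Jstar\<close> to \<open>Jstar'\<close>
  and the task frontier from \<open>M\<close> to \<open>M'\<close>. The interval integrals are oriented, so a frontier or
  threshold that moves down counts with a negative sign.
\<close>

definition technological_unemployment ::
    "real \<Rightarrow> real \<Rightarrow> real \<Rightarrow> (real \<Rightarrow> real) \<Rightarrow> real \<Rightarrow> real \<Rightarrow> real \<Rightarrow> real \<Rightarrow> real" where
  "technological_unemployment D W \<sigma> Al Jstar Jstar' M M' =
     (LBINT j=Jstar..Jstar'. task_labor D W \<sigma> Al j) - (LBINT j=M..M'. task_labor D W \<sigma> Al j)"

text \<open>
  To differentiate technological unemployment with respect to total employment it has to be read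
  as a function of total employment: the demand factor is the one at which the labor tasks
  \<open>(Jstar, M]\<close> employ \<open>L\<close> in total. It is unique whenever employment is not identically zero, see
  \<open>demand_level_total_employment\<close> below.
\<close>

definition demand_level ::
    "real \<Rightarrow> real \<Rightarrow> (real \<Rightarrow> real) \<Rightarrow> real \<Rightarrow> real \<Rightarrow> real \<Rightarrow> real" where
  "demand_level W \<sigma> Al Jstar M L = (THE D. total_employment D W \<sigma> Al Jstar M = L)"

text \<open>
  In the next two definitions \<open>dM\<close>, \<open>dm\<close> and \<open>m\<close> stand for the increment of the frontier \<open>M\<close>, the
  increment of the automation measure, and the automation measure \<open>m = M - Jstar\<close>; hence the
  threshold moves from \<open>M - m\<close> to \<open>M - m + (dM - dm)\<close>.
\<close>

definition unemployment_fun ::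
    "real \<Rightarrow> real \<Rightarrow> (real \<Rightarrow> real) \<Rightarrow> real \<Rightarrow> real \<Rightarrow> real \<Rightarrow> real \<Rightarrow> real \<Rightarrow> real" where
  "unemployment_fun W \<sigma> Al M L dM dm m =
     technological_unemployment (demand_level W \<sigma> Al (M - m) M L) W \<sigma> Al
       (M - m) (M - m + (dM - dm)) M (M + dM)"

definition unemployment_L ::
    "real \<Rightarrow> real \<Rightarrow> (real \<Rightarrow> real) \<Rightarrow> real \<Rightarrow> real \<Rightarrow> real \<Rightarrow> real \<Rightarrow> real \<Rightarrow> real" where
  "unemployment_L W \<sigma> Al M L dM dm m =
     deriv (\<lambda>L. unemployment_fun W \<sigma> Al M L dM dm m) L"

lemma task_labor_scale: "task_labor D W \<sigma> Al = (\<lambda>j. D * task_labor 1 W \<sigma> Al j)"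
  by (simp add: fun_eq_iff task_labor_def task_demand_def)

lemma total_employment_scale:
  "total_employment D W \<sigma> Al Jstar M = D * total_employment 1 W \<sigma> Al Jstar M"
  unfolding total_employment_def by (subst task_labor_scale) simp

lemma technological_unemployment_scale:
  "technological_unemployment D W \<sigma> Al Jstar Jstar' M M' =
     D * technological_unemployment 1 W \<sigma> Al Jstar Jstar' M M'"
  unfolding technological_unemployment_def task_labor_scale[of D]
  by (simp add: right_diff_distrib)

lemma demand_level_eq:
  assumes "total_employment 1 W \<sigma> Al Jstar M \<noteq> 0"
  shows "demand_level W \<sigma> Al Jstar M L = L / total_employment 1 W \<sigma> Al Jstar M"
  unfolding demand_level_def
proof (rule the_equality)
  show "total_employment (L / total_employment 1 W \<sigma> Al Jstar M) W \<sigma> Al Jstar M = L"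
    using assms by (subst total_employment_scale) simp
next
  fix D assume "total_employment D W \<sigma> Al Jstar M = L"
  then have "D * total_employment 1 W \<sigma> Al Jstar M = L"
    by (subst (asm) total_employment_scale)
  then show "D = L / total_employment 1 W \<sigma> Al Jstar M"
    using assms by (simp add: field_simps)
qed

lemma demand_level_total_employment:
  assumes "total_employment D W \<sigma> Al Jstar M \<noteq> 0"
  shows "demand_level W \<sigma> Al Jstar M (total_employment D W \<sigma> Al Jstar M) = D"
proof -
  have "total_employment 1 W \<sigma> Al Jstar M \<noteq> 0"
    using assms by (subst (asm) total_employment_scale) auto
  then show ?thesis
    by (simp add: demand_level_eq total_employment_scale[of D])
qed

lemma unemployment_fun_total_employment:
  assumes "total_employment D W \<sigma> Al Jstar M \<noteq> 0"
  shows "unemployment_fun W \<sigma> Al M (total_employment D W \<sigma> Al Jstar M) dM dm (M - Jstar) =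
         technological_unemployment D W \<sigma> Al Jstar (Jstar + (dM - dm)) M (M + dM)"
  using demand_level_total_employment[OF assms] by (simp add: unemployment_fun_def)

lemma unemployment_fun_has_derivative:
  assumes "total_employment 1 W \<sigma> Al (M - m) M \<noteq> 0"
  shows "((\<lambda>L. unemployment_fun W \<sigma> Al M L dM dm m) has_real_derivative
           unemployment_L W \<sigma> Al M L dM dm m) (at L)"
proof -
  have "((\<lambda>L. unemployment_fun W \<sigma> Al M L dM dm m) has_real_derivative
           technological_unemployment 1 W \<sigma> Al (M - m) (M - m + (dM - dm)) M (M + dM) /
           total_employment 1 W \<sigma> Al (M - m) M) (at L)"
    unfolding unemployment_fun_def demand_level_eq[OF assms]
    by (subst technological_unemployment_scale) (use assms in \<open>auto intro!: derivative_eq_intros\<close>)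
  then show ?thesis
    unfolding unemployment_L_def by (metis DERIV_imp_deriv)
qed

end

(*
  With \<kappa> = \<alpha> (\<sigma> - 1), labor per task is a positive multiple of exp (\<kappa> j), so displacement minus
  reinstatement is employment on the old range of labor tasks minus employment on the new one.
  Relative to the former, this difference is
    u(dM, dm, m) = 1 - exp (\<kappa> (dM - dm)) (exp (\<kappa> (m + dm)) - 1) / (exp (\<kappa> m) - 1),
  which is the derivative of unemployment with respect to employment. At dm = 0 it reduces to
  1 - exp (\<kappa> dM), independent of m and with the sign of -\<kappa> dM. In dm it is decreasing for either
  sign of \<kappa>, because \<kappa> / (exp (\<kappa> m) - 1) > 0.
*)

theory Submission
  imports Defs
begin

text \<open>At \<open>m = 0\<close> the quotient is a division by zero, so the value there is the
  convention \<open>1\<close>; the lemmas that use the rate assume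
  \<open>m \<noteq> 0\<close>.\<close>

definition unemployment_rate :: "real \<Rightarrow> real \<Rightarrow> real \<Rightarrow> real \<Rightarrow> real" where
  "unemployment_rate \<kappa> dM dm m =
     1 - exp (\<kappa> * (dM - dm)) * ((exp (\<kappa> * (m + dm)) - 1) / (exp (\<kappa> * m) - 1))"

text \<open>For positive \<open>x\<close>, \<open>exp (k * x) - 1\<close> has the sign of
  \<open>k\<close>. This makes the effect of \<open>dm\<close> negative on both sides of
  \<open>\<sigma> = 1\<close>.\<close>

lemma pos_div_exp_minus_1:
  fixes k x :: real
  assumes "k \<noteq> 0" "x > 0"
  shows "k / (exp (k * x) - 1) > 0"
  using assms by (cases "k > 0") (auto simp: zero_less_divide_iff mult_less_0_iff)

text \<open>Demand contributes the exponent \<open>\<sigma> * (\<alpha> * j)\<close>; dividing by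
  productivity takes away one \<open>\<alpha> * j\<close>, which leaves the factor
  \<open>\<sigma> - 1\<close>.\<close>

lemma task_labor_exp:
  assumes "W > 0"
  shows "task_labor D W \<sigma> (\<lambda>j. exp (\<alpha> * j)) j = D * W powr (-\<sigma>) * exp (\<alpha> * (\<sigma> - 1) * j)"
proof -
  have "(W / exp (\<alpha> * j)) powr (-\<sigma>) = W powr (-\<sigma>) * exp (\<sigma> * (\<alpha> * j))"
    using assms by (simp add: powr_def ln_div algebra_simps flip: exp_add)
  moreover have "exp (\<sigma> * (\<alpha> * j)) / exp (\<alpha> * j) = exp (\<alpha> * (\<sigma> - 1) * j)"
    by (simp add: algebra_simps flip: exp_diff)
  ultimately show ?thesis
    by (simp add: task_labor_def task_demand_def flip: times_divide_eq_right)
qed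

text \<open>The integral is oriented, so no order between \<open>a\<close> and \<open>b\<close> is
  required; this covers a frontier or threshold that moves down.\<close>

lemma interval_integral_exp:
  fixes c k a b :: real
  assumes "k \<noteq> 0"
  shows "(LBINT j=a..b. c * exp (k * j)) = c / k * (exp (k * b) - exp (k * a))"
proof -
  have "(LBINT j=a..b. c * exp (k * j)) = c / k * exp (k * b) - c / k * exp (k * a)"
    by (rule interval_integral_FTC_finite)
      (use assms in \<open>auto intro!: continuous_intros derivative_eq_intros
         simp flip: has_real_derivative_iff_has_vector_derivative\<close>)
  then show ?thesis
    by (simp add: right_diff_distrib)
qed

lemma total_employment_exp:
  assumes "W > 0" "\<alpha> * (\<sigma> - 1) \<noteq> 0"
  shows "total_employment D W \<sigma> (\<lambda>j. exp (\<alpha> * j)) a b =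
    D * W powr (-\<sigma>) / (\<alpha> * (\<sigma> - 1)) * (exp (\<alpha> * (\<sigma> - 1) * b) - exp (\<alpha> * (\<sigma> - 1) * a))"
  unfolding total_employment_def task_labor_exp[OF \<open>W > 0\<close>]
  by (rule interval_integral_exp[OF assms(2)])

text \<open>Injectivity of \<open>exp\<close> gives this; it is the condition under which
  \<open>demand_level\<close> is determined by employment.\<close>

lemma total_employment_exp_nonzero:
  assumes "W > 0" "\<alpha> * (\<sigma> - 1) \<noteq> 0" "D \<noteq> 0" "a \<noteq> b"
  shows "total_employment D W \<sigma> (\<lambda>j. exp (\<alpha> * j)) a b \<noteq> 0"
  using assms by (auto simp: total_employment_exp)

text \<open>The new range of labor tasks has length \<open>m + dm\<close> and starts
  \<open>dM - dm\<close> above the old one. The shift multiplies employment by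
  \<open>exp (k * (dM - dm))\<close>, and the change in length gives the quotient in the
  rate.\<close>

lemma technological_unemployment_exp:
  assumes "W > 0" "\<alpha> * (\<sigma> - 1) \<noteq> 0" "m \<noteq> 0"
  shows "technological_unemployment D W \<sigma> (\<lambda>j. exp (\<alpha> * j)) (M - m) (M - m + (dM - dm)) M (M + dM) =
    total_employment D W \<sigma> (\<lambda>j. exp (\<alpha> * j)) (M - m) M * unemployment_rate (\<alpha> * (\<sigma> - 1)) dM dm m"
proof -
  define k where "k = \<alpha> * (\<sigma> - 1)"
  define C where "C = D * W powr (-\<sigma>) / k"
  have k: "k \<noteq> 0" using assms by (simp add: k_def)
  have E: "exp (k * m) - 1 \<noteq> 0" using k \<open>m \<noteq> 0\<close> by simp
  have employment: "total_employment D W \<sigma> (\<lambda>j. exp (\<alpha> * j)) a b = C * (exp (k * b) - exp (k * a))"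
    for a b using assms by (simp add: total_employment_exp k_def C_def)
  \<comment> \<open>Factor out the exponential at the lower end of the range; the rest depends only
    on its length.\<close>
  have L: "C * (exp (k * M) - exp (k * (M - m))) = C * exp (k * (M - m)) * (exp (k * m) - 1)"
    by (simp add: algebra_simps flip: exp_add)
  have "technological_unemployment D W \<sigma> (\<lambda>j. exp (\<alpha> * j)) (M - m) (M - m + (dM - dm)) M (M + dM) =
      C * (exp (k * (M - m + (dM - dm))) - exp (k * (M - m))) - C * (exp (k * (M + dM)) - exp (k * M))"
    using employment unfolding technological_unemployment_def total_employment_def by simp
  \<comment> \<open>The four exponentials are regrouped as old range minus new range, the new one
    again factored at its lower end.\<close>
  also have "\<dots> = C * (exp (k * M) - exp (k * (M - m)))
      - C * exp (k * (M - m)) * exp (k * (dM - dm)) * (exp (k * (m + dm)) - 1)"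
    by (simp add: algebra_simps flip: exp_add)
  also have "\<dots> = C * exp (k * (M - m)) * (exp (k * m) - 1) * unemployment_rate k dM dm m"
    using E unfolding L unemployment_rate_def by (simp add: field_simps)
  also have "\<dots> = total_employment D W \<sigma> (\<lambda>j. exp (\<alpha> * j)) (M - m) M * unemployment_rate k dM dm m"
    by (simp add: employment L)
  finally show ?thesis
    by (simp add: k_def)
qed

text \<open>Once the demand factor is chosen to produce employment \<open>L\<close>, unemployment is
  linear in \<open>L\<close> with the rate as slope.\<close>

lemma unemployment_L_exp:
  assumes "W > 0" "\<alpha> * (\<sigma> - 1) \<noteq> 0" "m \<noteq> 0"
  shows "unemployment_L W \<sigma> (\<lambda>j. exp (\<alpha> * j)) M L dM dm m = unemployment_rate (\<alpha> * (\<sigma> - 1)) dM dm m"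
proof -
  have nz: "total_employment 1 W \<sigma> (\<lambda>j. exp (\<alpha> * j)) (M - m) M \<noteq> 0"
    using assms by (intro total_employment_exp_nonzero) auto
  have "unemployment_fun W \<sigma> (\<lambda>j. exp (\<alpha> * j)) M L dM dm m = unemployment_rate (\<alpha> * (\<sigma> - 1)) dM dm m * L"
    for L
    unfolding unemployment_fun_def technological_unemployment_exp[OF assms] demand_level_eq[OF nz]
    by (subst total_employment_scale) (use nz in simp)
  then show ?thesis
    by (simp add: unemployment_L_def)
qed

lemma unemployment_rate_steady:
  assumes "k \<noteq> 0" "m \<noteq> 0"
  shows "unemployment_rate k dM 0 m = 1 - exp (k * dM)"
  using assms by (simp add: unemployment_rate_def)

lemma unemployment_rate_has_derivative_dM:
  assumes "k \<noteq> 0" "m \<noteq> 0"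
  shows "((\<lambda>x. unemployment_rate k x 0 m) has_real_derivative - (k * exp (k * dM))) (at dM)"
  unfolding unemployment_rate_steady[OF assms] by (auto intro!: derivative_eq_intros)

lemma unemployment_rate_has_derivative_dm:
  assumes "k \<noteq> 0" "m \<noteq> 0"
  shows "((\<lambda>x. unemployment_rate k dM x m) has_real_derivative
           - (exp (k * (dM - dm)) * (k / (exp (k * m) - 1)))) (at dm)"
proof -
  have E: "exp (k * m) - 1 \<noteq> 0" using assms by simp
  \<comment> \<open>Multiplying out cancels \<open>x\<close> in the exponent of the first term, so
    only \<open>exp (k * (dM - x))\<close> has to be differentiated.\<close>
  have "(\<lambda>x. unemployment_rate k dM x m) =
      (\<lambda>x. 1 - (exp (k * (dM + m)) - exp (k * (dM - x))) / (exp (k * m) - 1))"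
    by (simp add: fun_eq_iff unemployment_rate_def algebra_simps diff_divide_distrib flip: exp_add)
  then show ?thesis
    using E by (auto intro!: derivative_eq_intros)
qed

theorem lemma2:
  fixes \<alpha> \<sigma> A dt t :: real
    and Ak Al :: "real \<Rightarrow> real \<Rightarrow> real"
    and D W R M J Jtilde Jstar m mstar Mdot mdot L UA :: "real \<Rightarrow> real"
  assumes Ak: "\<And>s j. Ak s j = A" and "A > 0"
    and Al: "\<And>s j. Al s j = exp (\<alpha> * j)" and "\<alpha> > 0"
    and "\<sigma> > 0" and "\<sigma> \<noteq> 1"
    and "\<And>s. D s > 0" and "\<And>s. W s > 0" and "\<And>s. R s > 0"
    and cost_threshold: "\<And>s j. j \<le> Jtilde s \<longleftrightarrow> R s / Ak s j \<le> W s / Al s j"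
    and Jstar: "\<And>s. Jstar s = min (J s) (Jtilde s)"
    and m: "\<And>s. m s = M s - J s"
    and mstar: "\<And>s. mstar s = M s - Jstar s"
    and mstar_range: "\<And>s. mstar s \<in> {0<..<1}"
    and "dt > 0"
    and Mdot: "\<And>s. M (s + dt) - M s = Mdot s"
    and Jstardot: "\<And>s. Jstar (s + dt) - Jstar s = Mdot s - mdot s"
    and L: "\<And>s. L s = total_employment (D s) (W s) \<sigma> (Al s) (Jstar s) (M s)"
    and UA: "\<And>s. UA s = technological_unemployment (D s) (W s) \<sigma> (Al s)
                            (Jstar s) (Jstar (s + dt)) (M s) (M (s + dt))"
  shows "UA t = L t * (1 - exp (\<alpha> * (\<sigma> - 1) * (Mdot t - mdot t)) *
                 ((exp (\<alpha> * (\<sigma> - 1) * (mstar t + mdot t)) - 1) /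
                  (exp (\<alpha> * (\<sigma> - 1) * mstar t) - 1))) \<and>
    (mdot t = 0 \<longrightarrow>
    (\<sigma> > 1 \<longrightarrow>
      (Mdot t > 0 \<longrightarrow> unemployment_L (W t) \<sigma> (Al t) (M t) (L t) (Mdot t) (mdot t) (mstar t) < 0) \<and>
      (Mdot t < 0 \<longrightarrow> unemployment_L (W t) \<sigma> (Al t) (M t) (L t) (Mdot t) (mdot t) (mstar t) > 0) \<and>
      (\<exists>d<0. ((\<lambda>x. unemployment_L (W t) \<sigma> (Al t) (M t) (L t) x (mdot t) (mstar t))
               has_real_derivative d) (at (Mdot t))) \<and>
      (mstar t = m t \<longrightarrow>
         (\<exists>d<0. ((\<lambda>x. unemployment_L (W t) \<sigma> (Al t) (M t) (L t) (Mdot t) x (mstar t))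
                  has_real_derivative d) (at (mdot t)))) \<and>
      ((\<lambda>x. unemployment_L (W t) \<sigma> (Al t) (M t) (L t) (Mdot t) (mdot t) x)
         has_real_derivative 0) (at (mstar t))) \<and>
    (\<sigma> < 1 \<longrightarrow>
      (Mdot t > 0 \<longrightarrow> unemployment_L (W t) \<sigma> (Al t) (M t) (L t) (Mdot t) (mdot t) (mstar t) > 0) \<and>
      (Mdot t < 0 \<longrightarrow> unemployment_L (W t) \<sigma> (Al t) (M t) (L t) (Mdot t) (mdot t) (mstar t) < 0) \<and>
      (\<exists>d>0. ((\<lambda>x. unemployment_L (W t) \<sigma> (Al t) (M t) (L t) x (mdot t) (mstar t))
               has_real_derivative d) (at (Mdot t))) \<and>
      (mstar t = m t \<longrightarrow>
         (\<exists>d<0. ((\<lambda>x. unemployment_L (W t) \<sigma> (Al t) (M t) (L t) (Mdot t) x (mstar t))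
                  has_real_derivative d) (at (mdot t)))) \<and>
      ((\<lambda>x. unemployment_L (W t) \<sigma> (Al t) (M t) (L t) (Mdot t) (mdot t) x)
         has_real_derivative 0) (at (mstar t))))"
proof -
  define k where "k = \<alpha> * (\<sigma> - 1)"
  have k0: "\<alpha> * (\<sigma> - 1) \<noteq> 0" and "k \<noteq> 0"
    using \<open>\<alpha> > 0\<close> \<open>\<sigma> \<noteq> 1\<close> by (auto simp: k_def)
  have m_pos: "mstar t > 0"
    using mstar_range[of t] by simp
  have "W t > 0" by fact
  have Al_t: "Al t = (\<lambda>j. exp (\<alpha> * j))"
    using Al by (simp add: fun_eq_iff)
  have thresholds: "Jstar t = M t - mstar t" "M (t + dt) = M t + Mdot t"
      "Jstar (t + dt) = M t - mstar t + (Mdot t - mdot t)"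
    using mstar[of t] Mdot[of t] Jstardot[of t] by linarith+
  have UA_t: "UA t = L t * unemployment_rate k (Mdot t) (mdot t) (mstar t)"
    using technological_unemployment_exp[OF \<open>W t > 0\<close> k0] m_pos
    unfolding UA L Al_t thresholds k_def by simp
  have rate: "unemployment_L (W t) \<sigma> (Al t) (M t) (L t) x y z = unemployment_rate k x y z"
    if "z \<noteq> 0" for x y z
    unfolding Al_t k_def by (rule unemployment_L_exp[OF \<open>W t > 0\<close> k0 that])
  \<comment> \<open>With the last argument fixed at \<open>mstar t\<close> the equation is
    unconditional and can rewrite under a binder.\<close>
  note rate_t = rate[OF less_imp_neq[OF m_pos, symmetric]]
  have deriv_m: "((\<lambda>x. unemployment_L (W t) \<sigma> (Al t) (M t) (L t) (Mdot t) 0 x)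
         has_real_derivative 0) (at (mstar t))"
  \<comment> \<open>Here the automation measure itself varies and \<open>rate\<close> excludes the
    value 0, so agreement with a constant is shown on the open half-line around
    \<open>mstar t\<close>.\<close>
  proof (rule has_field_derivative_transform_within_open)
    show "((\<lambda>x. 1 - exp (k * Mdot t)) has_real_derivative 0) (at (mstar t))"
      by simp
    show "1 - exp (k * Mdot t) = unemployment_L (W t) \<sigma> (Al t) (M t) (L t) (Mdot t) 0 x"
      if "x \<in> {0<..}" for x
      using that \<open>k \<noteq> 0\<close> by (simp add: rate unemployment_rate_steady)
  qed (use m_pos in auto)
  have deriv_dM: "((\<lambda>x. unemployment_L (W t) \<sigma> (Al t) (M t) (L t) x 0 (mstar t))
         has_real_derivative - (k * exp (k * Mdot t))) (at (Mdot t))"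
    unfolding rate_t using \<open>k \<noteq> 0\<close> m_pos by (intro unemployment_rate_has_derivative_dM) auto
  have deriv_dm: "\<exists>d<0. ((\<lambda>x. unemployment_L (W t) \<sigma> (Al t) (M t) (L t) (Mdot t) x (mstar t))
         has_real_derivative d) (at 0)"
  proof (intro exI conjI)
    show "((\<lambda>x. unemployment_L (W t) \<sigma> (Al t) (M t) (L t) (Mdot t) x (mstar t))
        has_real_derivative - (exp (k * (Mdot t - 0)) * (k / (exp (k * mstar t) - 1)))) (at 0)"
      unfolding rate_t using \<open>k \<noteq> 0\<close> m_pos by (intro unemployment_rate_has_derivative_dm) auto
    show "- (exp (k * (Mdot t - 0)) * (k / (exp (k * mstar t) - 1))) < 0"
      using mult_pos_pos[OF exp_gt_zero pos_div_exp_minus_1[OF \<open>k \<noteq> 0\<close> m_pos]] by simp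
  qed
  have level: "unemployment_L (W t) \<sigma> (Al t) (M t) (L t) (Mdot t) 0 (mstar t) = 1 - exp (k * Mdot t)"
    using \<open>k \<noteq> 0\<close> m_pos by (simp add: rate_t unemployment_rate_steady)
  have k_sign: "\<sigma> > 1 \<Longrightarrow> k > 0" "\<sigma> < 1 \<Longrightarrow> k < 0"
    using \<open>\<alpha> > 0\<close> by (auto simp: k_def mult_less_0_iff)
  have deriv_dM_neg: "\<exists>d<0. ((\<lambda>x. unemployment_L (W t) \<sigma> (Al t) (M t) (L t) x 0 (mstar t))
         has_real_derivative d) (at (Mdot t))" if "\<sigma> > 1"
    using deriv_dM k_sign(1)[OF that] by (intro exI[of _ "- (k * exp (k * Mdot t))"]) simp
  have deriv_dM_pos: "\<exists>d>0. ((\<lambda>x. unemployment_L (W t) \<sigma> (Al t) (M t) (L t) x 0 (mstar t))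
         has_real_derivative d) (at (Mdot t))" if "\<sigma> < 1"
    using deriv_dM k_sign(2)[OF that] by (intro exI[of _ "- (k * exp (k * Mdot t))"])
      (simp add: mult_less_0_iff)
  have "1 - exp (k * Mdot t) < 0 \<longleftrightarrow> k * Mdot t > 0" "1 - exp (k * Mdot t) > 0 \<longleftrightarrow> k * Mdot t < 0"
    by auto
  then have level_sign:
    "\<sigma> > 1 \<Longrightarrow> Mdot t > 0 \<Longrightarrow> 1 - exp (k * Mdot t) < 0"
    "\<sigma> > 1 \<Longrightarrow> Mdot t < 0 \<Longrightarrow> 1 - exp (k * Mdot t) > 0"
    "\<sigma> < 1 \<Longrightarrow> Mdot t > 0 \<Longrightarrow> 1 - exp (k * Mdot t) > 0"
    "\<sigma> < 1 \<Longrightarrow> Mdot t < 0 \<Longrightarrow> 1 - exp (k * Mdot t) < 0"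
    using k_sign by (simp_all add: mult_less_0_iff zero_less_mult_iff)
  \<comment> \<open>The steady-state facts carry a literal \<open>0\<close>, which matches the goals
    after rewriting with \<open>mdot t = 0\<close>; folding with \<open>level\<close> turns the
    signs of \<open>1 - exp (k * Mdot t)\<close> into signs of
    \<open>unemployment_L\<close>.\<close>
  show ?thesis
    using UA_t[unfolded unemployment_rate_def k_def] deriv_m deriv_dm deriv_dM_neg deriv_dM_pos
      level_sign[folded level]
    by (intro conjI impI) (simp_all only:)
qed

end
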